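(* For every positive integer $h$, the vertex-forwarding index of the multiplicative circulant graph $\Gamma_{2^h}=MC(2^h)$ is $$\xi(\Gamma_{2^h})=\frac{(3h+1)2^h-(-1)^h}{9}-(2^h-1).$$
   Context: For integers $m>1$, $h>0$, $MC(m^h)$ is the graph with vertex set $\mathbb{Z}_{m^h}$ in which distinct vertices $x,y$ are adjacent iff $x-y\equiv \pm m^i \pmod{m^h}$ for some $i\in\{0,\ldots,h-1\}$. For a connected graph $\Gamma$ on $N$ vertices, a routing $R$ is a choice of one path $R(x,y)$ from $x$ to $y$ for each of the $N(N-1)$ ordered pairs $(x,y)$ of distinct vertices. The load $\xi_x(\Gamma,R)$ of a vertex $x$ is the number of paths of $R$ having $x$ as an inner (non-end) vertex; $\xi(\Gamma,R)=\max_x \xi_x(\Gamma,R)$; and the vertex-forwarding index is $\xi(\Gamma)=\min_R \xi(\Gamma,R)$ over all routings $R$ of $\Gamma$. *)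

theory Defs
  imports Complex_Main "HOL-Number_Theory.Cong" "Graph_Theory.Graph_Theory"
begin

text \<open>
  Undirected graphs are symmetric loop-free digraphs whose arcs are pairs of vertices
  (locale \<^locale>\<open>pair_graph\<close>). The residue ring of order \<open>m ^ h\<close> is represented by the
  integers \<open>0, \<dots>, m ^ h - 1\<close>.
\<close>

definition MC :: "nat \<Rightarrow> nat \<Rightarrow> int pair_pre_digraph" where
  "MC m h =
    \<lparr> pverts = {0..<int m ^ h},
      parcs = {(x, y). x \<in> {0..<int m ^ h} \<and> y \<in> {0..<int m ^ h} \<and> x \<noteq> y \<and>
        (\<exists>i<h. [x - y = int m ^ i] (mod int m ^ h) \<or> [x - y = - (int m ^ i)] (mod int m ^ h))} \<rparr>"

text \<open>
  A routing is a function on pairs of vertices; its values on pairs that are not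
  pairs of distinct vertices of the graph are irrelevant. A path is given by the list
  of its vertices.
\<close>

definition is_routing :: "'a pair_pre_digraph \<Rightarrow> ('a \<Rightarrow> 'a \<Rightarrow> 'a list) \<Rightarrow> bool" where
  "is_routing G R \<longleftrightarrow>
    (\<forall>x\<in>pverts G. \<forall>y\<in>pverts G. x \<noteq> y \<longrightarrow>
      vpath (R x y) (with_proj G) \<and> hd (R x y) = x \<and> last (R x y) = y)"

definition vertex_load :: "'a pair_pre_digraph \<Rightarrow> ('a \<Rightarrow> 'a \<Rightarrow> 'a list) \<Rightarrow> 'a \<Rightarrow> nat" where
  "vertex_load G R v =
    card {(x, y). x \<in> pverts G \<and> y \<in> pverts G \<and> x \<noteq> y \<and> v \<in> set (R x y) - {x, y}}"

definition max_vertex_load :: "'a pair_pre_digraph \<Rightarrow> ('a \<Rightarrow> 'a \<Rightarrow> 'a list) \<Rightarrow> nat" where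
  "max_vertex_load G R = Max (vertex_load G R ` pverts G)"

text \<open>
  \<^const>\<open>Inf\<close> of a nonempty set of natural numbers is its least element; routings exist for
  connected graphs.
\<close>

definition vertex_forwarding_index :: "'a pair_pre_digraph \<Rightarrow> nat" where
  "vertex_forwarding_index G = (INF R \<in> {R. is_routing G R}. max_vertex_load G R)"

lemma pair_graph_MC: "pair_graph (MC m h)"
proof
  have "parcs (MC m h) \<subseteq> pverts (MC m h) \<times> pverts (MC m h)"
    by (auto simp: MC_def)
  moreover have fin: "finite (pverts (MC m h))"
    by (simp add: MC_def)
  ultimately show "finite (parcs (MC m h))"
    by (meson finite_SigmaI finite_subset)
  show "finite (pverts (MC m h))" by (rule fin)
  have flip: "[y - x = - c] (mod n)" if "[x - y = c] (mod n)" for x y c n :: int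
    using cong_minus_minus_iff[of "x - y" c n] that by simp
  have "sym (parcs (MC m h))"
    unfolding sym_def MC_def using flip by fastforce
  then show "symmetric (with_proj (MC m h))"
    by (simp add: symmetric_def)
qed (auto simp: MC_def)

lemma is_routing_MC_exists:
  assumes "m > 1" and "h > 0"
  shows "\<exists>R. is_routing (MC m h) R"
proof -
  interpret pair_graph "MC m h" by (rule pair_graph_MC)
  let ?G = "with_proj (MC m h)"
  have nat_bound: "int k < int m ^ h \<longleftrightarrow> k < m ^ h" for k
    by (metis of_nat_less_iff of_nat_power)
  have arc: "(int k, int (Suc k)) \<in> parcs (MC m h)" if "Suc k < m ^ h" for k
  proof -
    have "int k < int m ^ h" "int (Suc k) < int m ^ h"
      unfolding nat_bound using that by auto
    then show ?thesis using assms by (auto simp: MC_def cong_def intro!: exI[of _ 0])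
  qed
  have up: "int 0 \<rightarrow>\<^sup>*\<^bsub>?G\<^esub> int k" if "k < m ^ h" for k
    using that
  proof (induction k)
    case 0
    then show ?case by (intro reachable_refl) (simp add: MC_def)
  next
    case (Suc k)
    then have "int 0 \<rightarrow>\<^sup>*\<^bsub>?G\<^esub> int k" by simp
    moreover have "(int k, int (Suc k)) \<in> parcs (MC m h)" using arc Suc.prems by simp
    ultimately show ?case by (rule reachable_adj_trans)
  qed
  have "0 \<rightarrow>\<^sup>*\<^bsub>?G\<^esub> x" if "x \<in> pverts (MC m h)" for x
    using up[of "nat x"] nat_bound[of "nat x"] that by (simp add: MC_def)
  then have "x \<rightarrow>\<^sup>*\<^bsub>?G\<^esub> y" if "x \<in> pverts (MC m h)" "y \<in> pverts (MC m h)" for x y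
    using that reachable_trans symmetric_reachable' by blast
  then have "\<exists>p. vpath p ?G \<and> hd p = x \<and> last p = y"
    if "x \<in> pverts (MC m h)" "y \<in> pverts (MC m h)" for x y
    using that reachable_vpath_conv by metis
  then have "\<exists>R. \<forall>x\<in>pverts (MC m h). \<forall>y\<in>pverts (MC m h).
      vpath (R x y) ?G \<and> hd (R x y) = x \<and> last (R x y) = y"
    by metis
  then show ?thesis unfolding is_routing_def by blast
qed

end

theory Submission
  imports Defs
begin

text \<open>
  The distance from \<open>z\<close> to \<open>0\<close> in \<open>MC 2 h\<close> is the least number of signed powers of two adding up to
  \<open>z\<close> modulo \<open>2 ^ h\<close>. It is attained by the non-adjacent form: if \<open>z\<close> is odd, spend one step to
  reach the neighbouring multiple of 4. Summing over the residues, split into \<open>2 j\<close>, \<open>4 j + 1\<close> and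
  \<open>4 j - 1\<close>, gives \<open>S (h + 2) = S (h + 1) + 2 S h + 2 ^ (h + 1)\<close> for the sum \<open>S h\<close> of all distances
  to \<open>0\<close>. By averaging, some vertex has load at least \<open>S h - (2 ^ h - 1)\<close> in every routing.
  Translating a fixed family of shortest paths to \<open>0\<close> loads all vertices equally and attains this.
\<close>

section \<open>Weights of residues modulo powers of two\<close>

text \<open>The number of nonzero digits of the non-adjacent form. For both
  \<open>z = 4 * k + 1\<close> and \<open>z = 4 * k - 1\<close> the quotient
  \<open>(z + 1) div 4\<close> is \<open>k\<close>, so one formula rounds either odd class to its
  neighbouring multiple of 4. Modulo 2 no such multiple is needed and 1 is a single step away from
  0.\<close>

fun naf_weight :: "nat \<Rightarrow> int \<Rightarrow> nat" where
  "naf_weight 0 z = 0"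
| "naf_weight (Suc 0) z = (if even z then 0 else 1)"
| "naf_weight (Suc (Suc h)) z =
    (if even z then naf_weight (Suc h) (z div 2) else Suc (naf_weight h ((z + 1) div 4)))"

lemma naf_weight_double [simp]: "naf_weight (Suc h) (2 * z) = naf_weight h z"
  by (cases h) auto

lemma naf_weight_quadruple_plus_1: "naf_weight (Suc (Suc h)) (4 * z + 1) = Suc (naf_weight h z)"
proof -
  have "(4 * z + 2) div 4 = z" by presburger
  then show ?thesis by (simp add: ac_simps)
qed

lemma naf_weight_quadruple_minus_1: "naf_weight (Suc (Suc h)) (4 * z - 1) = Suc (naf_weight h z)"
  by simp

lemma int_mod_4_cases:
  fixes z :: int
  obtains k where "z = 2 * k" | k where "z = 4 * k + 1" | k where "z = 4 * k - 1"
proof -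
  have "(\<exists>k. z = 2 * k) \<or> (\<exists>k. z = 4 * k + 1) \<or> (\<exists>k. z = 4 * k - 1)"
    by presburger
  then show ?thesis using that by blast
qed

text \<open>For modulus at least 4 the added multiple does not change the branch of the recursion,
  and it passes to the quotient as a multiple of the smaller modulus. Hence the weight is a function
  on residue classes.\<close>

lemma naf_weight_add_modulus: "naf_weight h (z + 2 ^ h * k) = naf_weight h z"
proof (induction h z arbitrary: k rule: naf_weight.induct)
  case (3 h z)
  show ?case
  proof (cases z rule: int_mod_4_cases)
    case (1 j)
    then have "z + 2 ^ Suc (Suc h) * k = 2 * (j + 2 ^ Suc h * k)" by simp
    then show ?thesis using 3(1)[of k] 1 by (simp only: naf_weight_double) simp
  next
    case (2 j)
    have "z + 2 ^ Suc (Suc h) * k = 4 * (j + 2 ^ h * k) + 1" using 2 by simp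
    moreover have "(4 * j + 2) div 4 = j" by presburger
    ultimately show ?thesis using 3(2)[of k] 2 by (simp only: naf_weight_quadruple_plus_1) simp
  next
    case (3 j)
    have "z + 2 ^ Suc (Suc h) * k = 4 * (j + 2 ^ h * k) - 1" using 3 by simp
    then show ?thesis using "3.IH"(2)[of k] 3 by (simp only: naf_weight_quadruple_minus_1) simp
  qed
qed auto

lemma naf_weight_cong:
  assumes "[x = y] (mod 2 ^ h)"
  shows "naf_weight h x = naf_weight h y"
  using assms naf_weight_add_modulus[of h x] by (metis cong_iff_lin)

lemma naf_weight_mod [simp]: "naf_weight h (z mod 2 ^ h) = naf_weight h z"
  by (rule naf_weight_cong) simp

text \<open>Every odd branch contributes 1, so weight 0 forces \<open>z\<close> to be halved at all
  \<open>h\<close> levels. Conversely, periodicity reduces to the weight of 0.\<close>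

lemma naf_weight_eq_0_iff: "naf_weight h z = 0 \<longleftrightarrow> [z = 0] (mod 2 ^ h)"
proof
  show "naf_weight h z = 0 \<Longrightarrow> [z = 0] (mod 2 ^ h)"
  proof (induction h z rule: naf_weight.induct)
    case (3 h z)
    then have "even z" by (auto split: if_splits)
    then obtain k where k: "z = 2 * k" by blast
    with 3 have "[k = 0] (mod 2 ^ Suc h)" by simp
    then show ?case unfolding k cong_0_iff power_Suc[of 2 "Suc h"]
      by (rule mult_dvd_mono[OF dvd_refl])
  qed (auto simp: cong_0_iff split: if_splits)
next
  have "naf_weight h 0 = 0"
    by (induction h "0 :: int" rule: naf_weight.induct) auto
  then show "[z = 0] (mod 2 ^ h) \<Longrightarrow> naf_weight h z = 0"
    using naf_weight_cong by fastforce
qed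

section \<open>Effect of a single step on the weight\<close>

text \<open>The minimality of the weight: one signed power of two changes it by at most 1. Having
  both inequalities covers subtraction too, by taking \<open>z - 2 ^ i\<close> for \<open>z\<close>.
  Strong induction is used because the recursion drops one or two levels and the exponent changes
  with it.\<close>

lemma naf_weight_step:
  assumes "i < h"
  shows "naf_weight h (z + 2 ^ i) \<le> Suc (naf_weight h z) \<and>
    naf_weight h z \<le> Suc (naf_weight h (z + 2 ^ i))"
  using assms
proof (induction h arbitrary: z i rule: less_induct)
  case (less n)
  \<comment> \<open>The induction hypothesis for exponent 0; at \<open>m = 0\<close> no exponent is
    available, but all weights vanish.\<close>
  have lip: "naf_weight m (x + 1) \<le> Suc (naf_weight m x) \<and>
      naf_weight m x \<le> Suc (naf_weight m (x + 1))"
    if "m < n" for m x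
    using less.IH[of m 0 x] that by (cases "m = 0") auto
  consider "n = 1" | h where "n = Suc (Suc h)"
    using less.prems by (metis One_nat_def less_nat_zero_code old.nat.exhaust)
  then show ?case
  proof cases
    case 1
    then show ?thesis by simp
  next
    case n: (2 h)
    txt \<open>This is why, from an odd residue, moving to the neighbouring multiple of 4 is optimal.\<close>
    have even_le_odd: "naf_weight h j \<le> naf_weight (Suc h) (2 * j + s)" if "s \<in> {1, -1}" for j s
    proof (cases h)
      case (Suc g)
      have "odd (2 * j + s)" using that by auto
      then consider l where "2 * j + s = 4 * l + 1" | l where "2 * j + s = 4 * l - 1"
        by (metis dvd_triv_left int_mod_4_cases)
      then show ?thesis
      proof cases
        case (1 l)
        then have "j = 2 * l \<or> j = 2 * l + 1" using that by auto
        then show ?thesis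
          using lip[of h "2 * l"] n Suc 1 naf_weight_quadruple_plus_1[of g l] by auto
      next
        case (2 l)
        then have "j = 2 * l \<or> j = 2 * l - 1" using that by auto
        then show ?thesis
          using lip[of h "2 * l - 1"] n Suc 2 naf_weight_quadruple_minus_1[of g l] by auto
      qed
    qed simp
    have lip': "naf_weight (Suc h) (2 * j + s) \<le> Suc (naf_weight h j)" if "s \<in> {1, -1}" for j s
      using that lip[of "Suc h" "2 * j"] lip[of "Suc h" "2 * j - 1"] n by auto
    have four: "naf_weight n (4 * j) = naf_weight h j" for j
      using naf_weight_double[of "Suc h" "2 * j"] n by simp
    consider "i = 0" | "i = 1" | k where "i = Suc (Suc k)"
      by (metis One_nat_def old.nat.exhaust)
    then show ?thesis
    proof cases
      case 1
      show ?thesis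
      \<comment> \<open>Exactly one of \<open>z\<close> and \<open>z + 1\<close> is odd. If the even
        one is a multiple of 4, the recursion gives a difference of exactly 1. Otherwise the even
        one halves to an odd number \<open>2 * j + s\<close>, to be compared with \<open>j\<close>
        by \<open>even_le_odd\<close> and \<open>lip'\<close>.\<close>
      proof (cases "z mod 4 = 0 \<or> z mod 4 = 3")
        case True
        then have "(\<exists>j. z = 4 * j) \<or> (\<exists>j. z = 4 * j - 1)" by presburger
        then consider j where "z = 4 * j" | j where "z = 4 * j - 1" by blast
        then show ?thesis
          by cases (use 1 n four naf_weight_quadruple_plus_1[of h] in \<open>auto\<close>)
      next
        case False
        then have "(\<exists>j. z = 4 * j + 1) \<or> (\<exists>j. z = 4 * j - 2)" by presburger
        then consider j where "z = 4 * j + 1" | j where "z = 4 * j - 2" by blast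
        then show ?thesis
        proof cases
          case (1 j)
          have "naf_weight n (z + 2 ^ i) = naf_weight (Suc h) (2 * j + 1)"
            using 1 \<open>i = 0\<close> n naf_weight_double[of "Suc h" "2 * j + 1"] by (simp add: ac_simps)
          then show ?thesis
            using 1 n even_le_odd[of 1 j] lip'[of 1 j] naf_weight_quadruple_plus_1[of h j] by auto
        next
          case (2 j)
          have "naf_weight n z = naf_weight (Suc h) (2 * j + -1)"
            using 2 n naf_weight_double[of "Suc h" "2 * j - 1"] by simp
          then show ?thesis
            using \<open>i = 0\<close> 2 n even_le_odd[of "-1" j] lip'[of "-1" j]
              naf_weight_quadruple_minus_1[of h j] by auto
        qed
      qed
    next
      \<comment> \<open>Adding 2 interchanges the odd classes: \<open>4 * j + 1\<close> becomes
        \<open>4 * (j + 1) - 1\<close>, whereas \<open>4 * j - 1\<close> becomes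
        \<open>4 * j + 1\<close> with the same weight. For even \<open>z\<close>, halving turns the
        step into 1.\<close>
      case 2
      show ?thesis
      proof (cases z rule: int_mod_4_cases)
        case (1 j)
        have "naf_weight n (z + 2 ^ i) = naf_weight (Suc h) (j + 1)"
            using 1 2 n naf_weight_double[of "Suc h" "j + 1"] by simp
        then show ?thesis using 1 n lip[of "Suc h" j] by simp
      next
        case (2 j)
        have "naf_weight n (z + 2 ^ i) = Suc (naf_weight h (j + 1))"
            using 2 \<open>i = 1\<close> n naf_weight_quadruple_minus_1[of h "j + 1"] by (simp add: algebra_simps)
        then show ?thesis using 2 n lip[of h j] naf_weight_quadruple_plus_1[of h j] by simp
      next
        case (3 j)
        have "z + 2 ^ i = 4 * j + 1" using 3 \<open>i = 1\<close> by simp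
        then have "naf_weight n (z + 2 ^ i) = Suc (naf_weight h j)"
          using n naf_weight_quadruple_plus_1[of h j] by simp
        then show ?thesis using 3 n naf_weight_quadruple_minus_1[of h j] by simp
      qed
    next
      \<comment> \<open>Now \<open>2 ^ i\<close> is divisible by 4, so the branch is preserved and
        the step descends to the quotient with exponent \<open>i - 1\<close> or
        \<open>i - 2\<close>.\<close>
      case (3 k)
      have k: "k < h" using 3 less.prems n by simp
      show ?thesis
      proof (cases z rule: int_mod_4_cases)
        case (1 j)
        have "naf_weight n (z + 2 ^ i) = naf_weight (Suc h) (j + 2 ^ Suc k)"
            using 1 3 n naf_weight_double[of "Suc h" "j + 2 ^ Suc k"] by simp
        then show ?thesis using 1 n less.IH[of "Suc h" "Suc k" j] k by simp
      next
        case (2 j)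
        have "naf_weight n (z + 2 ^ i) = Suc (naf_weight h (j + 2 ^ k))"
            using 2 3 n naf_weight_quadruple_plus_1[of h "j + 2 ^ k"] by (simp add: algebra_simps)
        then show ?thesis using 2 n less.IH[of h k j] k naf_weight_quadruple_plus_1[of h j] by simp
      next
        case (3 j)
        have "z + 2 ^ i = 4 * (j + 2 ^ k) - 1" using 3 \<open>i = Suc (Suc k)\<close> by simp
        then have "naf_weight n (z + 2 ^ i) = Suc (naf_weight h (j + 2 ^ k))"
          using n naf_weight_quadruple_minus_1[of h "j + 2 ^ k"] by simp
        then show ?thesis using 3 n less.IH[of h k j] k naf_weight_quadruple_minus_1[of h j] by simp
      qed
    qed
  qed
qed

text \<open>The steps prescribed by the non-adjacent form lower the weight: an odd residue moves by
  1 to its neighbouring multiple of 4, and an even one takes twice the step found for its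
  half.\<close>

lemma naf_weight_descent:
  assumes "naf_weight h z > 0"
  shows "\<exists>i<h. \<exists>s\<in>{1, -1}. naf_weight h z = Suc (naf_weight h (z + s * 2 ^ i))"
  using assms
proof (induction h z rule: naf_weight.induct)
  case (2 z)
  then show ?case by auto
next
  case (3 h z)
  show ?case
  proof (cases z rule: int_mod_4_cases)
    case (1 k)
    then obtain i s where "i < Suc h" "s \<in> {1, -1}"
        "naf_weight (Suc h) k = Suc (naf_weight (Suc h) (k + s * 2 ^ i))"
      using "3.IH"(1) "3.prems"
      by (metis naf_weight_double even_mult_iff even_numeral nonzero_mult_div_cancel_left zero_neq_numeral)
    moreover have "z + s * 2 ^ Suc i = 2 * (k + s * 2 ^ i)" using 1 by simp
    ultimately have "Suc i < Suc (Suc h)"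
        "naf_weight (Suc (Suc h)) z = Suc (naf_weight (Suc (Suc h)) (z + s * 2 ^ Suc i))"
      using 1 by (simp_all only: naf_weight_double Suc_less_eq)
    then show ?thesis using \<open>s \<in> _\<close> by blast
  next
    case (2 k)
    have "naf_weight (Suc (Suc h)) (z + (-1) * 2 ^ 0) = naf_weight h k"
      using 2 naf_weight_double[of "Suc h" "2 * k"] by simp
    then show ?thesis using 2 naf_weight_quadruple_plus_1[of h k] by (intro exI[of _ 0]) auto
  next
    case (3 k)
    have "naf_weight (Suc (Suc h)) (z + 1 * 2 ^ 0) = naf_weight h k"
      using 3 naf_weight_double[of "Suc h" "2 * k"] by simp
    then show ?thesis using 3 naf_weight_quadruple_minus_1[of h k] by (intro exI[of _ 0]) auto
  qed
qed auto

section \<open>The sum of all weights\<close>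

lemma sum_lessThan_double:
  fixes f :: "nat \<Rightarrow> 'a :: comm_monoid_add"
  shows "(\<Sum>i<2 * n. f i) = (\<Sum>i<n. f (2 * i)) + (\<Sum>i<n. f (2 * i + 1))"
  by (induction n) (simp_all add: ac_simps)

definition total_weight :: "nat \<Rightarrow> nat" where
  "total_weight h = (\<Sum>k<2 ^ h. naf_weight h (int k))"

lemma total_weight_rec:
  "total_weight (Suc (Suc h)) = total_weight (Suc h) + 2 * total_weight h + 2 ^ Suc h"
proof -
  let ?w = "\<lambda>k. naf_weight (Suc (Suc h)) (int k)"
  \<comment> \<open>The class \<open>4 * k + 3 = 4 * (k + 1) - 1\<close> produces weights at
    \<open>k + 1\<close>. Shifting the index only exchanges 0 for \<open>2 ^ h\<close>, which has
    the same weight.\<close>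
  have "(\<Sum>k<2 ^ h. naf_weight h (int k + 1)) + naf_weight h (int 0) =
      (\<Sum>k<2 ^ h. naf_weight h (int k)) + naf_weight h (int (2 ^ h))"
    using sum.lessThan_Suc_shift[of "\<lambda>k. naf_weight h (int k)" "2 ^ h"] by (simp add: ac_simps)
  moreover have "naf_weight h (int (2 ^ h)) = naf_weight h (int 0)"
    by (rule naf_weight_cong) (simp add: cong_def)
  ultimately have shift: "(\<Sum>k<2 ^ h. naf_weight h (int k + 1)) = total_weight h"
    by (simp add: total_weight_def)
  have "total_weight (Suc (Suc h)) = (\<Sum>k<2 ^ Suc h. ?w (2 * k)) + (\<Sum>k<2 ^ Suc h. ?w (2 * k + 1))"
    unfolding total_weight_def using sum_lessThan_double[of ?w "2 ^ Suc h"] by simp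
  also have "(\<Sum>k<2 ^ Suc h. ?w (2 * k)) = total_weight (Suc h)"
    unfolding total_weight_def using naf_weight_double by simp
  also have "(\<Sum>k<2 ^ Suc h. ?w (2 * k + 1)) =
      (\<Sum>k<2 ^ h. ?w (2 * (2 * k) + 1)) + (\<Sum>k<2 ^ h. ?w (2 * (2 * k + 1) + 1))"
    using sum_lessThan_double[of "\<lambda>k. ?w (2 * k + 1)" "2 ^ h"] by simp
  also have "(\<Sum>k<2 ^ h. ?w (2 * (2 * k) + 1)) = (\<Sum>k<2 ^ h. 1 + naf_weight h (int k))"
    using naf_weight_quadruple_plus_1[of h] by simp
  also have "\<dots> = 2 ^ h + total_weight h"
    unfolding total_weight_def by (subst sum.distrib) simp
  also have "(\<Sum>k<2 ^ h. ?w (2 * (2 * k + 1) + 1)) = (\<Sum>k<2 ^ h. 1 + naf_weight h (int k + 1))"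
    using naf_weight_quadruple_minus_1[of h "int _ + 1"] by (simp add: algebra_simps)
  also have "\<dots> = 2 ^ h + total_weight h"
    by (subst sum.distrib) (simp add: shift)
  finally show ?thesis by simp
qed

text \<open>The recurrence has characteristic roots 2 and -1; its inhomogeneous term is resonant
  with the root 2, whence the summand in \<open>h * 2 ^ h\<close>.\<close>

lemma total_weight_eq:
  "real (total_weight h) = ((3 * real h + 1) * 2 ^ h - (-1) ^ h) / 9"
proof (induction h rule: induct_nat_012)
  case (ge2 h)
  then show ?case by (simp add: total_weight_rec field_simps)
qed (simp_all add: total_weight_def numeral_2_eq_2)

section \<open>Walks, geodesics and translations of the graph\<close>

lemma pverts_MC_2 [simp]: "pverts (MC 2 h) = {0..<2 ^ h}"
  by (simp add: MC_def)

lemma parcs_MC_2_iff: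
  "(x, y) \<in> parcs (MC 2 h) \<longleftrightarrow> x \<in> {0..<2 ^ h} \<and> y \<in> {0..<2 ^ h} \<and> x \<noteq> y \<and>
    (\<exists>i<h. \<exists>s\<in>{1, -1}. [x = y + s * 2 ^ i] (mod 2 ^ h))"
proof -
  have "[x - y = c] (mod 2 ^ h) \<longleftrightarrow> [x = y + c] (mod 2 ^ h)" for c
    by (simp add: cong_iff_dvd_diff algebra_simps)
  then show ?thesis by (auto simp: MC_def)
qed

lemma naf_weight_arc:
  assumes "(x, y) \<in> parcs (MC 2 h)"
  shows "naf_weight h (x - c) \<le> Suc (naf_weight h (y - c))"
proof -
  obtain i s where step: "i < h" "s \<in> {1, -1}" "[x = y + s * 2 ^ i] (mod 2 ^ h)"
    using assms unfolding parcs_MC_2_iff by blast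
  have "[x - c = y - c + s * 2 ^ i] (mod 2 ^ h)"
    using cong_diff[OF step(3) cong_refl[of c]] by (simp add: algebra_simps)
  then have "naf_weight h (x - c) = naf_weight h (y - c + s * 2 ^ i)"
    by (rule naf_weight_cong)
  \<comment> \<open>The second instance, based at \<open>y - c - 2 ^ i\<close>, serves the sign
    \<open>s = -1\<close>.\<close>
  also have "\<dots> \<le> Suc (naf_weight h (y - c))"
    using naf_weight_step[OF step(1), of "y - c"]
      naf_weight_step[OF step(1), of "y - c - 2 ^ i"] step(2) by auto
  finally show ?thesis .
qed

text \<open>Each arc lowers the weight relative to the last vertex by at most 1, and that weight
  ends at 0. The list counts vertices, one more than the arcs.\<close>

lemma naf_weight_vwalk:
  assumes "vwalk p (with_proj (MC 2 h))"
  shows "Suc (naf_weight h (hd p - last p)) \<le> length p"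
  using assms
proof (induction rule: vwalk_induct)
  case (Base u)
  then show ?case by (simp add: naf_weight_eq_0_iff)
next
  case (Cons u v es)
  then show ?case using naf_weight_arc[of u v h "last (v # es)"] by auto
qed

text \<open>Iterating \<open>naf_weight_descent\<close> lowers the weight by exactly 1 per arc.
  Recording the whole list of weights yields both the length of the walk and the distinctness of its
  vertices.\<close>

lemma geodesic_exists:
  assumes "z \<in> {0..<2 ^ h}"
  shows "\<exists>p. vwalk p (with_proj (MC 2 h)) \<and> hd p = z \<and> last p = 0 \<and>
    map (naf_weight h) p = rev [0..<Suc (naf_weight h z)]"
  using assms
proof (induction "naf_weight h z" arbitrary: z)
  case 0
  then have "z = 0" using naf_weight_eq_0_iff[of h z] by (simp add: cong_def)
  with 0 show ?case by (intro exI[of _ "[0]"]) (auto simp: vwalk_def)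
next
  case (Suc n)
  then obtain i s where step: "i < h" "s \<in> {1, -1}"
      "naf_weight h z = Suc (naf_weight h (z + s * 2 ^ i))"
    using naf_weight_descent[of h z] by (metis zero_less_Suc)
  define y where "y = (z + s * 2 ^ i) mod 2 ^ h"
  have y: "y \<in> {0..<2 ^ h}" "naf_weight h y = n"
    using step Suc by (simp_all add: y_def)
  then obtain p where p: "vwalk p (with_proj (MC 2 h))" "hd p = y" "last p = 0"
      "map (naf_weight h) p = rev [0..<Suc n]"
    using Suc.hyps(1)[of y] by blast
  have "[y + (- s) * 2 ^ i = z + s * 2 ^ i + (- s) * 2 ^ i] (mod 2 ^ h)"
    by (intro cong_add cong_refl) (simp add: y_def)
  then have "[z = y + (- s) * 2 ^ i] (mod 2 ^ h)" by (simp add: cong_sym)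
  moreover have "- s \<in> {1, -1}" using step by auto
  moreover have "z \<noteq> y" using y Suc.hyps by auto
  ultimately have "(z, y) \<in> parcs (MC 2 h)"
    using step(1) y Suc.prems unfolding parcs_MC_2_iff by blast
  then have "vwalk (z # p) (with_proj (MC 2 h))"
    using p Suc.prems by (intro vwalk_consI) auto
  moreover have "p \<noteq> []" using p(1) by auto
  ultimately show ?case using p Suc.hyps(2) by (intro exI[of _ "z # p"]) auto
qed

text \<open>Adjacency depends only on the difference modulo \<open>2 ^ h\<close>, so translations
  are automorphisms. They carry geodesics to 0 into geodesics to any other target.\<close>

lemma arc_translate:
  assumes "(x, y) \<in> parcs (MC 2 h)"
  shows "((c + x) mod 2 ^ h, (c + y) mod 2 ^ h) \<in> parcs (MC 2 h)"
proof -
  obtain i s where step: "x \<in> {0..<2 ^ h}" "y \<in> {0..<2 ^ h}" "x \<noteq> y"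
      "i < h" "s \<in> {1, -1}" "[x = y + s * 2 ^ i] (mod 2 ^ h)"
    using assms unfolding parcs_MC_2_iff by blast
  have "[c + x = c + y + s * 2 ^ i] (mod 2 ^ h)"
    using cong_add[OF cong_refl[of c] step(6)] by (simp add: algebra_simps)
  then have "[(c + x) mod 2 ^ h = (c + y) mod 2 ^ h + s * 2 ^ i] (mod 2 ^ h)"
    by (simp add: cong_def mod_simps)
  moreover have "(c + x) mod 2 ^ h \<noteq> (c + y) mod 2 ^ h"
    using step(1-3) cong_add_lcancel[of c x y "2 ^ h"] by (auto simp: cong_def)
  ultimately show ?thesis using step unfolding parcs_MC_2_iff by auto
qed

lemma vwalk_translate:
  assumes "vwalk p (with_proj (MC 2 h))"
  shows "vwalk (map (\<lambda>u. (c + u) mod 2 ^ h) p) (with_proj (MC 2 h))"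
  using assms
proof (induction rule: vwalk_induct)
  case (Base u)
  then show ?case by (auto simp: vwalk_def)
next
  case (Cons u v es)
  then show ?case
    using arc_translate[of u v h c] by (auto intro!: vwalk_consI)
qed

section \<open>Counting inner vertices\<close>

lemma card_inner_vertices:
  assumes "distinct p" "p \<noteq> []" "hd p \<noteq> last p"
  shows "card (set p - {hd p, last p}) = length p - 2"
  using assms by (simp add: card_Diff_subset distinct_card)

text \<open>A geodesic from \<open>z\<close> to 0 has \<open>naf_weight h z - 1\<close> inner
  vertices, so this is their total over all sources. Positivity of the weights keeps the
  natural-number subtraction exact.\<close>

lemma sum_naf_weight_minus_1:
  "(\<Sum>z\<in>{0..<2 ^ h} - {0}. naf_weight h z - 1) = total_weight h - (2 ^ h - 1)"
proof -
  have pos: "1 \<le> naf_weight h z" if "z \<in> {0..<2 ^ h} - {0}" for z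
    using that naf_weight_eq_0_iff[of h z] by (auto simp: cong_def Suc_le_eq)
  have img: "int ` {..<2 ^ h} = {0..<2 ^ h}"
    using image_int_atLeastLessThan[of 0 "2 ^ h"] by (simp add: lessThan_atLeast0)
  have "total_weight h = (\<Sum>z\<in>{0..<2 ^ h}. naf_weight h z)"
    by (simp add: total_weight_def sum.reindex flip: img)
  also have "\<dots> = (\<Sum>z\<in>{0..<2 ^ h} - {0}. naf_weight h z)"
    by (rule sum.mono_neutral_right) (auto simp: naf_weight_eq_0_iff)
  finally show ?thesis
    using sum_subtractf_nat[of "{0..<2 ^ h} - {0}" "\<lambda>_. 1" "naf_weight h"] pos
    by (simp add: nat_power_eq)
qed

lemma sum_translate:
  fixes f :: "int \<Rightarrow> nat"
  assumes "y \<in> {0..<2 ^ h}"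
  shows "(\<Sum>x\<in>{0..<2 ^ h} - {y}. f ((x - y) mod 2 ^ h)) = (\<Sum>z\<in>{0..<2 ^ h} - {0}. f z)"
proof (rule sum.reindex_bij_witness[of _ "\<lambda>z. (z + y) mod 2 ^ h" "\<lambda>x. (x - y) mod 2 ^ h"])
  fix x assume "x \<in> {0..<2 ^ h} - {y}"
  moreover from this have "(x - y) mod 2 ^ h \<noteq> 0"
    using assms mod_eq_dvd_iff[of x "2 ^ h" y] by auto
  ultimately show "(x - y) mod 2 ^ h \<in> {0..<2 ^ h} - {0}" by auto
next
  fix z :: int assume z: "z \<in> {0..<2 ^ h} - {0}"
  then have "\<not> [z + y = y] (mod 2 ^ h)"
    using cong_add_rcancel[of z y 0 "2 ^ h"] by (auto simp: cong_def)
  then show "(z + y) mod 2 ^ h \<in> {0..<2 ^ h} - {y}"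
    using assms by (auto simp: cong_def)
qed (use assms in \<open>auto simp: mod_simps\<close>)

text \<open>Double counting of the triples \<open>(x, y, v)\<close> in which \<open>v\<close> is an
  inner vertex of \<open>R x y\<close>.\<close>

lemma sum_vertex_load:
  assumes "finite (pverts G)" and "is_routing G R"
  shows "(\<Sum>v\<in>pverts G. vertex_load G R v) =
    (\<Sum>y\<in>pverts G. \<Sum>x\<in>pverts G - {y}. length (R x y) - 2)"
proof -
  let ?V = "pverts G"
  have R: "set (R x y) \<subseteq> ?V" "distinct (R x y)" "R x y \<noteq> []" "hd (R x y) = x" "last (R x y) = y"
    if "x \<in> ?V" "y \<in> ?V" "x \<noteq> y" for x y
    using assms(2) that by (auto simp: is_routing_def vpath_def vwalk_def)
  have "(\<Sum>v\<in>?V. vertex_load G R v) =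
      (\<Sum>v\<in>?V. \<Sum>y\<in>?V. \<Sum>x\<in>?V - {y}. if v \<in> set (R x y) - {x, y} then 1 else 0)"
  proof (rule sum.cong[OF refl])
    fix v
    have "(\<Sum>y\<in>?V. \<Sum>x\<in>?V - {y}. if v \<in> set (R x y) - {x, y} then 1 else 0) =
        (\<Sum>y\<in>?V. card {x \<in> ?V - {y}. v \<in> set (R x y) - {x, y}})"
      using assms(1) by (simp add: sum.If_cases Int_def)
    also have "\<dots> = card (SIGMA y:?V. {x \<in> ?V - {y}. v \<in> set (R x y) - {x, y}})"
      using assms(1) by (subst card_SigmaI) auto
    also have "\<dots> = vertex_load G R v"
      unfolding vertex_load_def
      by (rule bij_betw_same_card[of prod.swap]) (rule bij_betw_byWitness[of _ prod.swap], auto)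
    finally show "vertex_load G R v =
        (\<Sum>y\<in>?V. \<Sum>x\<in>?V - {y}. if v \<in> set (R x y) - {x, y} then 1 else 0)" by simp
  qed
  also have "\<dots> = (\<Sum>y\<in>?V. \<Sum>x\<in>?V - {y}. \<Sum>v\<in>?V. if v \<in> set (R x y) - {x, y} then 1 else 0)"
    by (subst sum.swap, rule sum.cong[OF refl], rule sum.swap)
  also have "\<dots> = (\<Sum>y\<in>?V. \<Sum>x\<in>?V - {y}. length (R x y) - 2)"
  proof (intro sum.cong refl)
    fix x y assume "y \<in> ?V" "x \<in> ?V - {y}"
    then have xy: "x \<in> ?V" "y \<in> ?V" "x \<noteq> y" by auto
    have "(\<Sum>v\<in>?V. if v \<in> set (R x y) - {x, y} then 1 else 0) =
        card (?V \<inter> (set (R x y) - {x, y}))"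
      using assms(1) by (simp add: sum.If_cases Int_def)
    also have "?V \<inter> (set (R x y) - {x, y}) = set (R x y) - {x, y}"
      using R(1)[OF xy] by auto
    also have "card \<dots> = length (R x y) - 2"
      using card_inner_vertices[of "R x y"] R[OF xy] xy by simp
    finally show "(\<Sum>v\<in>?V. if v \<in> set (R x y) - {x, y} then 1 else 0) = length (R x y) - 2" .
  qed
  finally show ?thesis .
qed

section \<open>Lower bound by averaging and a routing that attains it\<close>

lemma max_vertex_load_ge:
  assumes "is_routing (MC 2 h) R"
  shows "total_weight h - (2 ^ h - 1) \<le> max_vertex_load (MC 2 h) R"
proof -
  let ?V = "{0..<2 ^ h} :: int set"
  let ?L = "total_weight h - (2 ^ h - 1)"
  \<comment> \<open>By translation each of the \<open>2 ^ h\<close> targets \<open>y\<close>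
    contributes \<open>?L\<close>.\<close>
  have "2 ^ h * ?L = (\<Sum>y\<in>?V. \<Sum>x\<in>?V - {y}. naf_weight h ((x - y) mod 2 ^ h) - 1)"
    unfolding sum_naf_weight_minus_1[symmetric]
    using sum_translate[of _ h "\<lambda>z. naf_weight h z - 1"]
    by (simp add: nat_power_eq del: naf_weight_mod)
  also have "\<dots> \<le> (\<Sum>y\<in>?V. \<Sum>x\<in>?V - {y}. length (R x y) - 2)"
  proof (intro sum_mono)
    fix x y assume "y \<in> ?V" "x \<in> ?V - {y}"
    then have "vwalk (R x y) (with_proj (MC 2 h))" "hd (R x y) = x" "last (R x y) = y"
      using assms by (auto simp: is_routing_def vpath_def)
    then show "naf_weight h ((x - y) mod 2 ^ h) - 1 \<le> length (R x y) - 2"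
      using naf_weight_vwalk[of "R x y" h] by simp
  qed
  also have "\<dots> = (\<Sum>v\<in>?V. vertex_load (MC 2 h) R v)"
    using sum_vertex_load[OF _ assms] by simp
  also have "\<dots> \<le> (\<Sum>v\<in>?V. max_vertex_load (MC 2 h) R)"
    unfolding max_vertex_load_def by (intro sum_mono Max_ge) auto
  finally show ?thesis by (simp add: nat_power_eq)
qed

lemma exists_balanced_routing:
  "\<exists>R. is_routing (MC 2 h) R \<and> max_vertex_load (MC 2 h) R \<le> total_weight h - (2 ^ h - 1)"
proof -
  let ?V = "{0..<2 ^ h} :: int set"
  obtain Q where Q: "vwalk (Q z) (with_proj (MC 2 h))" "hd (Q z) = z" "last (Q z) = 0"
      "map (naf_weight h) (Q z) = rev [0..<Suc (naf_weight h z)]" if "z \<in> ?V" for z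
    using geodesic_exists[of _ h] by metis
  have Q_dist: "distinct (Q z)" and Q_len: "length (Q z) = Suc (naf_weight h z)"
    and Q_V: "set (Q z) \<subseteq> ?V" and Q_ne: "Q z \<noteq> []"
    if "z \<in> ?V" for z
  proof -
    \<comment> \<open>Strictly decreasing weights prevent a vertex from being repeated.\<close>
    have "distinct (map (naf_weight h) (Q z))" unfolding Q(4)[OF that] by simp
    then show "distinct (Q z)" by (simp add: distinct_map)
    show "length (Q z) = Suc (naf_weight h z)"
      using arg_cong[OF Q(4)[OF that], of length] by simp
    show "set (Q z) \<subseteq> ?V" "Q z \<noteq> []" using Q(1)[OF that] by (auto simp: vwalk_def)
  qed
  define R where "R x y = map (\<lambda>u. (y + u) mod 2 ^ h) (Q ((x - y) mod 2 ^ h))" for x y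
  have "is_routing (MC 2 h) R"
    unfolding is_routing_def
  proof (intro ballI impI conjI vpathI)
    fix x y assume xy: "x \<in> pverts (MC 2 h)" "y \<in> pverts (MC 2 h)" "x \<noteq> y"
    have z: "(x - y) mod 2 ^ h \<in> ?V" by simp
    show "vwalk (R x y) (with_proj (MC 2 h))"
      unfolding R_def by (rule vwalk_translate[OF Q(1)[OF z]])
    have "inj_on (\<lambda>u. (y + u) mod 2 ^ h) ?V"
    proof (rule inj_onI)
      fix u v :: int assume uv: "u \<in> ?V" "v \<in> ?V" "(y + u) mod 2 ^ h = (y + v) mod 2 ^ h"
      then have "[u = v] (mod 2 ^ h)"
        using cong_add_lcancel[of y u v "2 ^ h"] by (simp add: cong_def)
      then show "u = v" using uv by (simp add: cong_def)
    qed
    then show "distinct (R x y)"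
      unfolding R_def distinct_map using Q_dist[OF z] Q_V[OF z] inj_on_subset by blast
    show "hd (R x y) = x" "last (R x y) = y"
      using Q[OF z] Q_ne[OF z] xy by (auto simp: R_def hd_map last_map mod_simps)
  qed
  moreover have "vertex_load (MC 2 h) R v \<le> total_weight h - (2 ^ h - 1)" for v
  proof -
    let ?S = "SIGMA z:?V - {0}. set (Q z) - {z, 0}"
    \<comment> \<open>If \<open>v\<close> is inner on \<open>R x y\<close>, it is the translate by
      \<open>y\<close> of an inner vertex \<open>u\<close> of \<open>Q z\<close>, where
      \<open>z\<close> is the residue of \<open>x - y\<close>. Then \<open>y\<close> is the residue
      of \<open>v - u\<close>, so \<open>(z, u)\<close> determines \<open>(x, y)\<close>. The
      resulting bound, the size of \<open>?S\<close>, does not depend on \<open>v\<close>.\<close>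
    let ?g = "\<lambda>(z, u). ((v - u + z) mod 2 ^ h, (v - u) mod 2 ^ h)"
    have "{(x, y). x \<in> ?V \<and> y \<in> ?V \<and> x \<noteq> y \<and> v \<in> set (R x y) - {x, y}} \<subseteq> ?g ` ?S"
    proof (rule subrelI)
      fix x y assume "(x, y) \<in> {(x, y). x \<in> ?V \<and> y \<in> ?V \<and> x \<noteq> y \<and> v \<in> set (R x y) - {x, y}}"
      then have xy: "x \<in> ?V" "y \<in> ?V" "x \<noteq> y" "v \<in> set (R x y)" "v \<notin> {x, y}"
        by auto
      define z where "z = (x - y) mod 2 ^ h"
      obtain u where u: "u \<in> set (Q z)" "v = (y + u) mod 2 ^ h"
        using xy by (auto simp: R_def z_def)
      have "u \<noteq> 0" "u \<noteq> z" using u xy by (auto simp: z_def mod_simps)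
      moreover have "z \<noteq> 0"
        using xy mod_eq_dvd_iff[of x "2 ^ h" y] by (auto simp: z_def)
      ultimately have S: "(z, u) \<in> ?S" using u by (simp add: z_def)
      have "[v - u + z = y + u - u + (x - y)] (mod 2 ^ h)"
        by (intro cong_add cong_diff cong_refl) (simp_all add: u z_def)
      then have "(x, y) = ?g (z, u)"
        using u xy by (simp add: cong_def mod_simps)
      with S show "(x, y) \<in> ?g ` ?S" by (rule rev_image_eqI)
    qed
    then have "vertex_load (MC 2 h) R v \<le> card (?g ` ?S)"
      unfolding vertex_load_def pverts_MC_2 by (rule card_mono[rotated]) auto
    also have "\<dots> \<le> card ?S" by (rule card_image_le) auto
    also have "\<dots> = (\<Sum>z\<in>?V - {0}. card (set (Q z) - {z, 0}))" by simp
    also have "\<dots> = (\<Sum>z\<in>?V - {0}. naf_weight h z - 1)"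
    proof (intro sum.cong refl)
      fix z assume "z \<in> ?V - {0}"
      then have z: "z \<in> ?V" "z \<noteq> 0" by auto
      show "card (set (Q z) - {z, 0}) = naf_weight h z - 1"
        using card_inner_vertices[of "Q z"] Q[OF z(1)] Q_dist[OF z(1)] Q_len[OF z(1)] Q_ne[OF z(1)] z
        by simp
    qed
    finally show ?thesis by (simp only: sum_naf_weight_minus_1)
  qed
  then have "max_vertex_load (MC 2 h) R \<le> total_weight h - (2 ^ h - 1)"
    unfolding max_vertex_load_def by (intro Max.boundedI) auto
  ultimately show ?thesis by blast
qed

section \<open>The forwarding index in closed form\<close>

text \<open>Makes the natural-number difference agree with the real one. In the recurrence the
  summands \<open>total_weight (Suc h)\<close> and \<open>2 ^ Suc h\<close> already suffice.\<close>

lemma total_weight_ge: "2 ^ h - 1 \<le> total_weight h"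
proof (induction h rule: induct_nat_012)
  case (ge2 h)
  then show ?case by (simp add: total_weight_rec)
qed (simp_all add: total_weight_def numeral_2_eq_2)

theorem theorem3p29:
  fixes h :: nat
  assumes "h > 0"
  shows "real (vertex_forwarding_index (MC 2 h)) =
    ((3 * real h + 1) * 2 ^ h - (-1) ^ h) / 9 - (2 ^ h - 1)"
proof -
  obtain R where R: "is_routing (MC 2 h) R"
      "max_vertex_load (MC 2 h) R \<le> total_weight h - (2 ^ h - 1)"
    using exists_balanced_routing by blast
  have "vertex_forwarding_index (MC 2 h) = total_weight h - (2 ^ h - 1)"
    unfolding vertex_forwarding_index_def
  proof (rule antisym)
    show "(INF R \<in> {R. is_routing (MC 2 h) R}. max_vertex_load (MC 2 h) R)
        \<le> total_weight h - (2 ^ h - 1)"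
      using R by (intro cINF_lower2[of _ _ R]) auto
    show "total_weight h - (2 ^ h - 1)
        \<le> (INF R \<in> {R. is_routing (MC 2 h) R}. max_vertex_load (MC 2 h) R)"
      using R(1) max_vertex_load_ge by (intro cINF_greatest) blast+
  qed
  then show ?thesis
    using total_weight_eq[of h] total_weight_ge[of h] by (simp add: of_nat_diff)
qed

end
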